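(* Let $m,n\in\mathbf{Z}\smallsetminus\{0\}$. The Baumslag--Solitar group $\mathrm{BS}(m,n)=\langle s,t\mid ts^mt^{-1}=s^n\rangle$ is presentable by a product if and only if $|m|=|n|$.
   Context: An infinite group $\Gamma$ is presentable by a product if there exist groups $\Gamma_1,\Gamma_2$ and a homomorphism $\varphi\colon\Gamma_1\times\Gamma_2\longrightarrow\Gamma$ such that $\varphi(\Gamma_1\times\{1\})$ and $\varphi(\{1\}\times\Gamma_2)$ are both infinite and $\varphi(\Gamma_1\times\Gamma_2)$ is of finite index in $\Gamma$. *)

theory Defs
  imports "HOL-Algebra.Algebra"
begin

section \<open>Groups given by generators and relations\<close>

text \<open>
  A letter \<open>(x, True)\<close> stands for the generator \<open>x\<close> and \<open>(x, False)\<close> for its formal inverse.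
\<close>

type_synonym 'g word = "('g \<times> bool) list"

text \<open>
  A pair \<open>(u, v)\<close> in \<open>R\<close> is the relation \<open>u = v\<close>.  The predicate below is the smallest congruence
  on the monoid of words that contains \<open>R\<close> and makes the letters \<open>x\<close> and \<open>x\<^sup>-\<^sup>1\<close> mutually inverse,
  so the group of its classes is the group presented by all elements of the type \<open>'g\<close> as
  generators, subject to the relations \<open>R\<close>.
\<close>

inductive word_equiv :: "('g word \<times> 'g word) set \<Rightarrow> 'g word \<Rightarrow> 'g word \<Rightarrow> bool"
  for R :: "('g word \<times> 'g word) set" where
  refl: "word_equiv R u u"
| sym: "word_equiv R u v \<Longrightarrow> word_equiv R v u"
| trans: "word_equiv R u v \<Longrightarrow> word_equiv R v w \<Longrightarrow> word_equiv R u w"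
| append: "word_equiv R u u' \<Longrightarrow> word_equiv R v v' \<Longrightarrow> word_equiv R (u @ v) (u' @ v')"
| cancel: "word_equiv R [(x, b), (x, \<not> b)] []"
| relation: "(u, v) \<in> R \<Longrightarrow> word_equiv R u v"

definition word_class :: "('g word \<times> 'g word) set \<Rightarrow> 'g word \<Rightarrow> 'g word set" where
  "word_class R u = {v. word_equiv R u v}"

definition presented_group :: "('g word \<times> 'g word) set \<Rightarrow> 'g word set monoid" where
  "presented_group R =
    \<lparr> carrier = range (word_class R),
      monoid.mult = (\<lambda>A B. {w. \<exists>u\<in>A. \<exists>v\<in>B. word_equiv R (u @ v) w}),
      one = word_class R [] \<rparr>"

lemma word_class_eq_iff: "word_class R u = word_class R v \<longleftrightarrow> word_equiv R u v"
  unfolding word_class_def by (auto intro: word_equiv.intros dest: word_equiv.sym word_equiv.trans)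

lemma carrier_presented_group: "carrier (presented_group R) = range (word_class R)"
  by (simp add: presented_group_def)

lemma one_presented_group: "\<one>\<^bsub>presented_group R\<^esub> = word_class R []"
  by (simp add: presented_group_def)

lemma mult_presented_group:
  "word_class R u \<otimes>\<^bsub>presented_group R\<^esub> word_class R v = word_class R (u @ v)"
  unfolding presented_group_def word_class_def
  by (auto intro: word_equiv.refl dest: word_equiv.append intro: word_equiv.trans)

definition word_inverse :: "'g word \<Rightarrow> 'g word" where
  "word_inverse u = rev (map (\<lambda>(x, b). (x, \<not> b)) u)"

lemma word_inverse_left: "word_equiv R (word_inverse u @ u) []"
proof (induction u)
  case Nil
  show ?case by (simp add: word_inverse_def word_equiv.refl)
next
  case (Cons a u)
  obtain x b where a: "a = (x, b)" by (cases a)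
  have "word_equiv R [(x, \<not> b), (x, b)] []"
    using word_equiv.cancel[of R x "\<not> b"] by simp
  then have "word_equiv R (word_inverse u @ [(x, \<not> b), (x, b)] @ u) (word_inverse u @ [] @ u)"
    by (intro word_equiv.append word_equiv.refl)
  then have "word_equiv R (word_inverse (a # u) @ a # u) (word_inverse u @ u)"
    by (simp add: a word_inverse_def)
  then show ?case using Cons.IH word_equiv.trans by blast
qed

lemma group_presented_group: "group (presented_group R)"
proof (rule groupI)
  fix A assume "A \<in> carrier (presented_group R)"
  then obtain u where A: "A = word_class R u" by (auto simp: carrier_presented_group)
  have "word_class R (word_inverse u) \<otimes>\<^bsub>presented_group R\<^esub> A = \<one>\<^bsub>presented_group R\<^esub>"
    by (simp add: A mult_presented_group one_presented_group word_class_eq_iff word_inverse_left)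
  then show "\<exists>B\<in>carrier (presented_group R). B \<otimes>\<^bsub>presented_group R\<^esub> A = \<one>\<^bsub>presented_group R\<^esub>"
    by (auto simp: carrier_presented_group)
qed (auto simp: carrier_presented_group one_presented_group mult_presented_group)


section \<open>Baumslag--Solitar groups\<close>

datatype bs_gen = gen_s | gen_t

definition word_power :: "'g \<Rightarrow> int \<Rightarrow> 'g word" where
  "word_power x k = replicate (nat \<bar>k\<bar>) (x, 0 \<le> k)"

text \<open>\<open>BS m n\<close> is the group with generators \<open>s, t\<close> and the single relation
  \<open>t s\<^sup>m t\<^sup>-\<^sup>1 = s\<^sup>n\<close>.\<close>

definition BS :: "int \<Rightarrow> int \<Rightarrow> bs_gen word set monoid" where
  "BS m n = presented_group
    {(word_power gen_t 1 @ word_power gen_s m @ word_power gen_t (- 1), word_power gen_s n)}"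


section \<open>Presentability by a product\<close>

text \<open>
  HOL cannot quantify over types inside a formula, so the carrier types \<open>'b\<close> and \<open>'c\<close> of the two
  factors are explicit parameters.  Only infinite types can occur, because both images have to be
  infinite; ``there exist groups'' is thus rendered by letting \<open>'b\<close> and \<open>'c\<close> range over all
  infinite types.
\<close>

definition presentable_by_product ::
    "'b itself \<Rightarrow> 'c itself \<Rightarrow> ('a, 'd) monoid_scheme \<Rightarrow> bool" where
  "presentable_by_product TYPE('b) TYPE('c) G \<longleftrightarrow>
    group G \<and> infinite (carrier G) \<and>
    (\<exists>(G1 :: 'b monoid) (G2 :: 'c monoid) \<phi>.
      group G1 \<and> group G2 \<and> \<phi> \<in> hom (G1 \<times>\<times> G2) G \<and>
      infinite (\<phi> ` (carrier G1 \<times> {\<one>\<^bsub>G2\<^esub>})) \<and>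
      infinite (\<phi> ` ({\<one>\<^bsub>G1\<^esub>} \<times> carrier G2)) \<and>
      finite (rcosets\<^bsub>G\<^esub> (\<phi> ` carrier (G1 \<times>\<times> G2))))"

end

theory Submission
  imports Defs
begin

text \<open>
  If \<open>n = \<plusminus>m\<close>, then \<open>z = s\<^sup>m\<close> has infinite order and every element conjugates it to \<open>z\<close> or
  \<open>z\<^sup>-\<^sup>1\<close>, so \<open>\<langle>z\<rangle> \<times> C(z)\<close> maps onto the centralizer \<open>C(z)\<close>, of index at most two.

  Conversely, let \<open>A\<close> and \<open>B\<close> be commuting subgroups with \<open>AB\<close> of finite index and let
  \<open>\<bar>m\<bar> \<noteq> \<bar>n\<bar>\<close>.  The group acts on the rationals by \<open>s x = x + 1\<close> and \<open>t x = (n / m) x\<close>, and \<open>AB\<close>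
  contains powers of \<open>s\<close> and \<open>t\<close>.  Since affine maps that are not translations have a unique fixed
  point, one of the factors, say \<open>B\<close>, acts trivially.  Britton normal forms show that no
  nontrivial element of the kernel of the action commutes with a power \<open>t\<^sup>j\<close>, \<open>j > 0\<close>: such an
  element is conjugate into \<open>\<langle>s\<rangle>\<close>, where the action is faithful.  Writing \<open>t\<^sup>j = ab\<close>, the element
  \<open>b\<close> commutes with \<open>t\<^sup>j\<close>, so \<open>b = 1\<close>; then \<open>t\<^sup>j = a\<close> commutes with \<open>B\<close>, so \<open>B\<close> is trivial.
\<close>

section \<open>Commuting subgroups and finite index\<close>

lemma (in monoid) commutes_nat_pow:
  assumes "x \<in> carrier G" "y \<in> carrier G" and "x \<otimes> y = y \<otimes> x"
  shows "x \<otimes> y [^] (k::nat) = y [^] k \<otimes> x"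
proof (induction k)
  case (Suc k)
  have "x \<otimes> y [^] Suc k = (y [^] k \<otimes> x) \<otimes> y"
    using assms Suc by (simp flip: m_assoc)
  then show ?case using assms by (simp add: m_assoc)
qed (use assms in simp)

text \<open>Pigeonhole: two of the cosets \<open>H #> g [^] i\<close> coincide, and the quotient of
  the two powers lies in \<open>H\<close>.\<close>

lemma (in group) finite_index_power_mem:
  assumes H: "subgroup H G" and fin: "finite (rcosets H)" and g: "g \<in> carrier G"
  obtains k :: nat where "k > 0" "g [^] k \<in> H"
proof -
  have "range (\<lambda>i::nat. H #> g [^] i) \<subseteq> rcosets H"
    using H g by (auto simp: RCOSETS_def)
  then have "\<not> inj (\<lambda>i::nat. H #> g [^] i)"
    using finite_subset[OF _ fin] range_inj_infinite by auto
  then obtain i j :: nat where ij: "i < j" "H #> g [^] i = H #> g [^] j"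
    by (rule contrapos_np) (rule linorder_injI, blast)
  then have "g [^] j \<in> H #> g [^] i" using rcos_self[OF _ H] g by simp
  then obtain h where h: "h \<in> H" "g [^] j = h \<otimes> g [^] i" by (auto simp: r_coset_def)
  have "g [^] j = g [^] (j - i) \<otimes> g [^] i" using ij g by (simp add: nat_pow_mult)
  with h have "g [^] (j - i) = h"
    using g subgroup.mem_carrier[OF H h(1)] by (metis nat_pow_closed right_cancel)
  then show ?thesis using that[of "j - i"] ij h by simp
qed

text \<open>The factors must live on prescribed infinite types; a countable group is transported
  there along an injection of \<open>nat\<close>.\<close>

lemma (in group) countable_group_copy:
  assumes "countable (carrier G)" and "infinite (UNIV :: 'c set)"
  obtains K :: "'c monoid" and f where "group K" "f \<in> hom K G" "f ` carrier K = carrier G"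
proof -
  obtain e :: "nat \<Rightarrow> 'c" where e: "inj e"
    using infinite_countable_subset[OF assms(2)] by blast
  define h where "h = e \<circ> to_nat_on (carrier G)"
  have inj: "inj_on h (carrier G)"
    unfolding h_def
    by (rule comp_inj_on[OF inj_on_to_nat_on[OF assms(1)] inj_on_subset[OF e]]) simp
  define f where "f = inv_into (carrier G) h"
  have fh [simp]: "f (h x) = x" if "x \<in> carrier G" for x
    using inj that by (simp add: f_def)
  define K where "K = \<lparr>carrier = h ` carrier G, monoid.mult = (\<lambda>x y. h (f x \<otimes> f y)), one = h \<one>\<rparr>"
  have "group K"
  proof (rule groupI)
    fix x assume "x \<in> carrier K"
    then obtain y where "y \<in> carrier G" "x = h y" by (auto simp: K_def)
    then show "\<exists>x'\<in>carrier K. x' \<otimes>\<^bsub>K\<^esub> x = \<one>\<^bsub>K\<^esub>"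
      by (simp add: K_def) (metis inv_closed l_inv)
  qed (auto simp: K_def m_assoc)
  moreover have "f \<in> hom K G" by (rule homI) (auto simp: K_def)
  moreover have "f ` carrier K = carrier G" by (force simp: K_def image_image)
  ultimately show ?thesis using that by blast
qed

lemma (in group) commuting_homs_prod:
  assumes f: "f \<in> hom G1 G" and g: "g \<in> hom G2 G"
    and comm: "\<And>x y. x \<in> carrier G1 \<Longrightarrow> y \<in> carrier G2 \<Longrightarrow> f x \<otimes> g y = g y \<otimes> f x"
  shows "(\<lambda>(x, y). f x \<otimes> g y) \<in> hom (G1 \<times>\<times> G2) G"
proof -
  have closed: "f x \<in> carrier G" "g y \<in> carrier G"
    if "x \<in> carrier G1" "y \<in> carrier G2" for x y
    using f g that by (auto simp: hom_def)
  show ?thesis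
  proof (rule homI)
    fix p q assume pq: "p \<in> carrier (G1 \<times>\<times> G2)" "q \<in> carrier (G1 \<times>\<times> G2)"
    obtain x y x' y' where "p = (x, y)" "q = (x', y')" by (cases p; cases q)
    with pq have xy: "p = (x, y)" "q = (x', y')" "x \<in> carrier G1" "x' \<in> carrier G1"
      "y \<in> carrier G2" "y' \<in> carrier G2" by auto
    have "f x \<otimes> f x' \<otimes> (g y \<otimes> g y') = f x \<otimes> (f x' \<otimes> g y) \<otimes> g y'"
      using closed xy by (simp add: m_assoc)
    also have "\<dots> = f x \<otimes> g y \<otimes> (f x' \<otimes> g y')"
      unfolding comm[OF xy(4,5)] using closed xy by (simp add: m_assoc)
    finally show "(case p \<otimes>\<^bsub>G1 \<times>\<times> G2\<^esub> q of (x, y) \<Rightarrow> f x \<otimes> g y) =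
        (case p of (x, y) \<Rightarrow> f x \<otimes> g y) \<otimes> (case q of (x, y) \<Rightarrow> f x \<otimes> g y)"
      using xy f g by (simp add: hom_mult)
  qed (use closed in auto)
qed

definition centralizer :: "('a, 'b) monoid_scheme \<Rightarrow> 'a \<Rightarrow> 'a set" where
  "centralizer G z = {g \<in> carrier G. g \<otimes>\<^bsub>G\<^esub> z = z \<otimes>\<^bsub>G\<^esub> g}"

lemma (in group) centralizer_subgroup:
  assumes z: "z \<in> carrier G"
  shows "subgroup (centralizer G z) G"
proof (rule subgroupI)
  fix g assume "g \<in> centralizer G z"
  then have g: "g \<in> carrier G" "g \<otimes> z = z \<otimes> g" by (auto simp: centralizer_def)
  then have "z = inv g \<otimes> (z \<otimes> g)" using z by (simp add: inv_solve_left)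
  then have "z \<otimes> inv g = inv g \<otimes> z" using g(1) z by (simp add: inv_solve_right' m_assoc)
  then show "inv g \<in> centralizer G z" using g(1) by (simp add: centralizer_def)
next
  fix g h assume "g \<in> centralizer G z" "h \<in> centralizer G z"
  then have gh: "g \<in> carrier G" "h \<in> carrier G" "g \<otimes> z = z \<otimes> g" "h \<otimes> z = z \<otimes> h"
    by (auto simp: centralizer_def)
  have "g \<otimes> h \<otimes> z = g \<otimes> (z \<otimes> h)" using gh z by (simp add: m_assoc)
  also have "\<dots> = g \<otimes> z \<otimes> h" using gh(1,2) z by (simp only: m_assoc)
  also have "\<dots> = z \<otimes> (g \<otimes> h)" unfolding gh(3) using gh(1,2) z by (simp add: m_assoc)
  finally show "g \<otimes> h \<in> centralizer G z" using gh(1,2) by (simp add: centralizer_def)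
qed (use z in \<open>auto simp: centralizer_def\<close>)

text \<open>The map \<open>(i, c) \<mapsto> z^i c\<close> on the product of the integers and
  \<open>C(z)\<close> has image \<open>C(z)\<close>, which contains the infinite group generated by
  \<open>z\<close>.\<close>

lemma (in group) presentable_if_centralizer_finite_index:
  assumes "countable (carrier G)"
    and z: "z \<in> carrier G" and z_inj: "inj (\<lambda>i::int. z [^] i)"
    and fin: "finite (rcosets (centralizer G z))"
    and inf: "infinite (UNIV :: 'c set)" "infinite (UNIV :: 'd set)"
  shows "presentable_by_product TYPE('c) TYPE('d) G"
proof -
  define C where "C = centralizer G z"
  have C: "subgroup C G" unfolding C_def by (rule centralizer_subgroup[OF z])
  note C_subset = subgroup.subset[OF C]
  interpret CG: group "G\<lparr>carrier := C\<rparr>" by (rule subgroup_imp_group[OF C])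
  interpret Z: group "integer_group :: int monoid" by (rule group_integer_group)
  have zC: "z [^] (i::int) \<in> C" for i
    by (rule subgroup_int_pow_closed[OF C]) (simp add: C_def centralizer_def z)
  have "countable (carrier (integer_group :: int monoid))" by simp
  from Z.countable_group_copy[OF this inf(1)]
  obtain K1 :: "'c monoid" and f1 where K1: "group K1" "f1 \<in> hom K1 (integer_group :: int monoid)"
    "f1 ` carrier K1 = carrier integer_group" .
  have "countable (carrier (G\<lparr>carrier := C\<rparr>))"
    using countable_subset[OF C_subset assms(1)] by simp
  from CG.countable_group_copy[OF this inf(2)]
  obtain K2 :: "'d monoid" and f2 where K2: "group K2" "f2 \<in> hom K2 (G\<lparr>carrier := C\<rparr>)"
    "f2 ` carrier K2 = carrier (G\<lparr>carrier := C\<rparr>)" .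
  have f2_image: "f2 ` carrier K2 = C" using K2(3) by simp
  then have f2C: "f2 y \<in> C" if "y \<in> carrier K2" for y using that by blast
  have f2: "f2 \<in> hom K2 G" using K2(2) C_subset by (auto simp: hom_def)
  define \<phi> where "\<phi> = (\<lambda>(x, y). z [^] f1 x \<otimes> f2 y)"
  have z_comm: "z [^] (i::int) \<otimes> c = c \<otimes> z [^] i" if "c \<in> C" for i c
  proof -
    have c: "c \<in> carrier G" "z \<otimes> c = c \<otimes> z" using that by (auto simp: C_def centralizer_def)
    \<comment> \<open>Swapping the roles of \<open>z\<close> and \<open>c\<close> yields all integer
      powers of \<open>z\<close> at once, as centralizers are subgroups.\<close>
    have "z \<in> centralizer G c" using c(2) z by (simp add: centralizer_def)
    then have "z [^] i \<in> centralizer G c"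
      by (rule subgroup_int_pow_closed[OF centralizer_subgroup[OF c(1)]])
    then show ?thesis by (simp add: centralizer_def)
  qed
  have "(\<lambda>x. z [^] f1 x) \<in> hom K1 G"
    by (rule homI) (use z hom_mult[OF K1(2)] in \<open>simp_all add: int_pow_mult\<close>)
  then have \<phi>: "\<phi> \<in> hom (K1 \<times>\<times> K2) G"
    unfolding \<phi>_def by (rule commuting_homs_prod[OF _ f2]) (rule z_comm[OF f2C])
  have one: "f1 \<one>\<^bsub>K1\<^esub> = 0" "f2 \<one>\<^bsub>K2\<^esub> = \<one>"
    using hom_one[OF K1(2) K1(1) group_integer_group] hom_one[OF f2 K2(1) is_group] by simp_all
  have "\<phi> ` (carrier K1 \<times> {\<one>\<^bsub>K2\<^esub>}) = (\<lambda>x. z [^] f1 x) ` carrier K1"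
    using z by (auto simp: \<phi>_def one image_iff)
  also have "\<dots> = range (\<lambda>i::int. z [^] i)"
    using K1(3) by (simp flip: image_image[of "\<lambda>i. z [^] i" f1])
  finally have inf1: "infinite (\<phi> ` (carrier K1 \<times> {\<one>\<^bsub>K2\<^esub>}))"
    using finite_imageD[OF _ z_inj] infinite_UNIV_int by auto
  have infC: "infinite C"
  proof
    assume "finite C"
    then have "finite (range (\<lambda>i::int. z [^] i))" by (rule finite_subset[rotated]) (use zC in auto)
    then show False using finite_imageD[OF _ z_inj] infinite_UNIV_int by auto
  qed
  have "\<phi> ` ({\<one>\<^bsub>K1\<^esub>} \<times> carrier K2) = (\<lambda>y. \<one> \<otimes> f2 y) ` carrier K2"
    by (auto simp: \<phi>_def one image_iff)
  also have "\<dots> = f2 ` carrier K2"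
    using subsetD[OF C_subset f2C] by (intro image_cong) simp_all
  finally have image2: "\<phi> ` ({\<one>\<^bsub>K1\<^esub>} \<times> carrier K2) = C" using f2_image by simp
  have "\<phi> ` carrier (K1 \<times>\<times> K2) \<subseteq> C"
    using f2C zC subgroup.m_closed[OF C] by (auto simp: \<phi>_def)
  moreover have "\<one>\<^bsub>K1\<^esub> \<in> carrier K1" using K1(1) by (simp add: group.is_monoid monoid.one_closed)
  then have "\<phi> ` ({\<one>\<^bsub>K1\<^esub>} \<times> carrier K2) \<subseteq> \<phi> ` carrier (K1 \<times>\<times> K2)"
    by (intro image_mono) auto
  ultimately have "\<phi> ` carrier (K1 \<times>\<times> K2) = C" using image2 by simp
  then have "finite (rcosets (\<phi> ` carrier (K1 \<times>\<times> K2)))" using fin by (simp add: C_def)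
  moreover have "infinite (carrier G)" using infC C_subset finite_subset by auto
  moreover have "infinite (\<phi> ` ({\<one>\<^bsub>K1\<^esub>} \<times> carrier K2))" using image2 infC by simp
  ultimately show ?thesis
    unfolding presentable_by_product_def
    by (intro conjI is_group exI[of _ K1] exI[of _ K2] exI[of _ \<phi>] K1(1) K2(1) \<phi> inf1)
qed

section \<open>The relation between powers of the generators\<close>

locale baumslag_solitar =
  fixes m n :: int
  assumes m_nonzero: "m \<noteq> 0" and n_nonzero: "n \<noteq> 0"
begin

definition rels :: "(bs_gen word \<times> bs_gen word) set" where
  "rels = {(word_power gen_t 1 @ word_power gen_s m @ word_power gen_t (- 1), word_power gen_s n)}"

abbreviation cls :: "bs_gen word \<Rightarrow> bs_gen word set" where
  "cls \<equiv> word_class rels"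

lemma BS_eq: "BS m n = presented_group rels"
  by (simp add: BS_def rels_def)

sublocale group "BS m n"
  by (simp add: BS_eq group_presented_group)

lemma carrier_BS: "carrier (BS m n) = range cls"
  by (simp add: BS_eq carrier_presented_group)

lemma one_BS: "\<one>\<^bsub>BS m n\<^esub> = cls []"
  by (simp add: BS_eq one_presented_group)

lemma cls_closed [simp]: "cls u \<in> carrier (BS m n)"
  by (simp add: carrier_BS)

lemma cls_append: "cls (u @ v) = cls u \<otimes>\<^bsub>BS m n\<^esub> cls v"
  by (simp add: BS_eq mult_presented_group)

lemma cls_Cons: "cls (x # v) = cls [x] \<otimes>\<^bsub>BS m n\<^esub> cls v"
  using cls_append[of "[x]" v] by simp

lemma cls_replicate: "cls (replicate k x) = cls [x] [^]\<^bsub>BS m n\<^esub> k"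
proof (induction k)
  case (Suc k)
  have "cls (replicate (Suc k) x) = cls [x] \<otimes>\<^bsub>BS m n\<^esub> cls (replicate k x)"
    using cls_Cons[of x "replicate k x"] by simp
  then show ?case using nat_pow_Suc2[of "cls [x]" k] by (simp add: Suc)
qed (simp add: one_BS)

lemma cls_inverse_letter: "cls [(x, False)] = inv\<^bsub>BS m n\<^esub> cls [(x, True)]"
proof -
  have "cls [(x, False)] \<otimes>\<^bsub>BS m n\<^esub> cls [(x, True)] = \<one>\<^bsub>BS m n\<^esub>"
    using word_equiv.cancel[of rels x False]
    by (simp add: one_BS word_class_eq_iff flip: cls_append)
  then show ?thesis by (simp add: inv_equality)
qed

lemma cls_word_power: "cls (word_power x k) = cls [(x, True)] [^]\<^bsub>BS m n\<^esub> k"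
proof (cases "0 \<le> k")
  case True
  then have "cls (word_power x k) = cls [(x, True)] [^]\<^bsub>BS m n\<^esub> nat k"
    unfolding word_power_def by (subst cls_replicate) simp
  then show ?thesis using True by (simp add: pow_nat)
next
  case False
  then have "cls (word_power x k) = (inv\<^bsub>BS m n\<^esub> cls [(x, True)]) [^]\<^bsub>BS m n\<^esub> nat (- k)"
    unfolding word_power_def by (subst cls_replicate) (simp add: cls_inverse_letter)
  also have "\<dots> = inv\<^bsub>BS m n\<^esub> (cls [(x, True)] [^]\<^bsub>BS m n\<^esub> nat (- k))" by (rule nat_pow_inv) simp
  finally show ?thesis using False int_pow_def2[of "BS m n" "cls [(x, True)]" k] by simp
qed

abbreviation S :: "bs_gen word set" where "S \<equiv> cls [(gen_s, True)]"
abbreviation T :: "bs_gen word set" where "T \<equiv> cls [(gen_t, True)]"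

lemma cls_relation:
  "T \<otimes>\<^bsub>BS m n\<^esub> S [^]\<^bsub>BS m n\<^esub> m \<otimes>\<^bsub>BS m n\<^esub> inv\<^bsub>BS m n\<^esub> T = S [^]\<^bsub>BS m n\<^esub> n"
proof -
  have "cls (word_power gen_t 1 @ word_power gen_s m @ word_power gen_t (- 1)) =
      cls (word_power gen_s n)"
    by (simp add: word_class_eq_iff rels_def word_equiv.relation)
  then show ?thesis
    by (simp add: cls_append cls_word_power int_pow_neg m_assoc)
qed

text \<open>Conjugation by \<open>T\<close> is an endomorphism, so it carries the relation to all
  integer powers of its two sides.\<close>

lemma T_conj_power:
  "T \<otimes>\<^bsub>BS m n\<^esub> S [^]\<^bsub>BS m n\<^esub> (m * q) = S [^]\<^bsub>BS m n\<^esub> (n * q) \<otimes>\<^bsub>BS m n\<^esub> T"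
proof -
  define h where "h x = T \<otimes>\<^bsub>BS m n\<^esub> x \<otimes>\<^bsub>BS m n\<^esub> inv\<^bsub>BS m n\<^esub> T" for x
  have "h \<in> hom (BS m n) (BS m n)"
    by (rule homI) (simp_all add: h_def m_assoc inv_solve_left)
  then have "h ((S [^]\<^bsub>BS m n\<^esub> m) [^]\<^bsub>BS m n\<^esub> q) = h (S [^]\<^bsub>BS m n\<^esub> m) [^]\<^bsub>BS m n\<^esub> q"
    by (simp add: hom_int_pow group_axioms)
  then have "T \<otimes>\<^bsub>BS m n\<^esub> S [^]\<^bsub>BS m n\<^esub> (m * q) \<otimes>\<^bsub>BS m n\<^esub> inv\<^bsub>BS m n\<^esub> T
      = S [^]\<^bsub>BS m n\<^esub> (n * q)"
    by (simp add: h_def cls_relation int_pow_pow)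
  then show ?thesis by (simp add: inv_solve_right')
qed

section \<open>The affine action on the rationals\<close>

primrec t_sign :: "bool \<Rightarrow> int" where
  "t_sign True = 1" | "t_sign False = - 1"

definition t_exp :: "bs_gen word \<Rightarrow> int" where
  "t_exp w = (\<Sum>(x, b)\<leftarrow>w. if x = gen_t then t_sign b else 0)"

lemma t_exp_simps [simp]:
  "t_exp [] = 0"
  "t_exp ((x, b) # w) = (if x = gen_t then t_sign b else 0) + t_exp w"
  "t_exp (u @ v) = t_exp u + t_exp v"
  by (simp_all add: t_exp_def)

lemma t_exp_replicate [simp]:
  "t_exp (replicate k (x, b)) = (if x = gen_t then int k * t_sign b else 0)"
  by (induction k) (auto simp: algebra_simps)

text \<open>Both sides of the defining relation have \<open>t\<close>-exponent sum zero.\<close>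

lemma t_exp_cong: "word_equiv rels u v \<Longrightarrow> t_exp u = t_exp v"
proof (induction rule: word_equiv.induct)
  case (cancel x b)
  then show ?case by (cases b) auto
qed (auto simp: rels_def word_power_def)

fun affine_letter :: "bs_gen \<times> bool \<Rightarrow> rat \<Rightarrow> rat" where
  "affine_letter (gen_s, b) x = (if b then x + 1 else x - 1)"
| "affine_letter (gen_t, b) x = (if b then of_int n / of_int m * x else of_int m / of_int n * x)"

definition affine :: "bs_gen word \<Rightarrow> rat \<Rightarrow> rat" where
  "affine w = foldr affine_letter w"

lemma affine_simps [simp]:
  "affine [] x = x"
  "affine (a # w) x = affine_letter a (affine w x)"
  "affine (u @ v) x = affine u (affine v x)"
  by (simp_all add: affine_def)

lemma affine_replicate_s [simp]:
  "affine (replicate k (gen_s, b)) x = (if b then x + of_nat k else x - of_nat k)"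
  by (induction k) auto

lemma affine_word_power_s [simp]: "affine (word_power gen_s k) x = x + of_int k"
  by (simp add: word_power_def)

text \<open>The relation is respected because
  \<open>n / m * (m / n * x + m) = x + n\<close>.\<close>

lemma affine_cong: "word_equiv rels u v \<Longrightarrow> affine u x = affine v x"
proof (induction arbitrary: x rule: word_equiv.induct)
  case (cancel y b)
  then show ?case using m_nonzero n_nonzero by (cases y; cases b) auto
next
  case (relation u v)
  then show ?case using m_nonzero n_nonzero
    by (auto simp: rels_def field_simps word_power_def[of gen_t])
qed auto

lemma affine_eq: "affine w x = (of_int n / of_int m) powi t_exp w * x + affine w 0"
proof (induction w)
  case (Cons a w)
  obtain y b where a: "a = (y, b)" by (cases a)
  have "(of_int n / of_int m :: rat) \<noteq> 0" using m_nonzero n_nonzero by simp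
  then have "(of_int n / of_int m :: rat) powi (1 + k) =
    of_int n / of_int m * (of_int n / of_int m) powi k"
    "(of_int n / of_int m :: rat) powi (- 1 + k) =
      of_int m / of_int n * (of_int n / of_int m) powi k" for k
    using power_int_add[of "of_int n / of_int m :: rat" 1 k]
      power_int_add[of "of_int n / of_int m :: rat" "- 1" k] by simp_all
  then show ?case
    by (subst affine_simps(2), subst affine_simps(2), subst Cons.IH, cases y; cases b)
      (simp_all add: a distrib_left)
qed simp

section \<open>Normal forms\<close>

text \<open>
  A state \<open>(k, L)\<close> with \<open>L = [(e\<^sub>1, r\<^sub>1), \<dots>, (e\<^sub>l, r\<^sub>l)]\<close> encodes the Britton normal form
  \<open>s\<^sup>k t\<^bsup>e1\<^esup> s\<^bsup>r1\<^esup> \<dots> t\<^bsup>el\<^esup> s\<^bsup>rl\<^esup>\<close>, where \<open>True\<close> and \<open>False\<close> stand for the exponents \<open>1\<close> and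
  \<open>-1\<close>; a letter acts on it by left multiplication.
\<close>

definition src :: "bool \<Rightarrow> int" where "src b = (if b then m else n)"

lemma src_nonzero [simp]: "src b \<noteq> 0"
  using m_nonzero n_nonzero by (simp add: src_def)

type_synonym state = "int \<times> (bool \<times> int) list"

text \<open>As \<open>t^b s^(src b) = s^(src (\<not> b)) t^b\<close>, the multiple of
  \<open>src b\<close> in \<open>s^k\<close> passes to the left of the new letter and the residue
  stays on its right; with residue zero, the letter cancels an inverse letter on top.\<close>

fun step :: "bs_gen \<times> bool \<Rightarrow> state \<Rightarrow> state" where
  "step (gen_s, b) (k, L) = (if b then k + 1 else k - 1, L)"
| "step (gen_t, b) (k, L) =
    (if L \<noteq> [] \<and> fst (hd L) = (\<not> b) \<and> src b dvd k
     then (src (\<not> b) * (k div src b) + snd (hd L), tl L)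
     else (src (\<not> b) * (k div src b), (b, k mod src b) # L))"

text \<open>Exponents to the right of a letter are canonical residues, whose sign follows
  \<open>src b\<close>, and no adjacent inverse letters remain; on such states the letters act
  invertibly.\<close>

fun reduced :: "(bool \<times> int) list \<Rightarrow> bool" where
  "reduced [] = True"
| "reduced ((b, r) # L) \<longleftrightarrow>
    r mod src b = r \<and> (r = 0 \<longrightarrow> L = [] \<or> fst (hd L) = b) \<and> reduced L"

definition run :: "bs_gen word \<Rightarrow> state \<Rightarrow> state" where
  "run w = foldr step w"

lemma run_simps [simp]:
  "run [] \<sigma> = \<sigma>"
  "run (a # w) \<sigma> = step a (run w \<sigma>)"
  "run (u @ v) \<sigma> = run u (run v \<sigma>)"
  by (simp_all add: run_def)

lemma reduced_step: "reduced (snd \<sigma>) \<Longrightarrow> reduced (snd (step a \<sigma>))"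
proof -
  assume red: "reduced (snd \<sigma>)"
  obtain x b k L where "a = (x, b)" "\<sigma> = (k, L)" by (cases a; cases \<sigma>)
  with red show ?thesis
    by (cases x; cases L) (auto simp: dvd_eq_mod_eq_0)
qed

lemma reduced_run: "reduced (snd \<sigma>) \<Longrightarrow> reduced (snd (run w \<sigma>))"
  by (induction w) (auto intro: reduced_step)

text \<open>A push is undone by a pop, since the exponent left in front is divisible. A pop is
  undone by a push: division recovers the quotient and the canonical residue, and reducedness rules
  out a second pop.\<close>

lemma step_cancel:
  assumes "reduced (snd \<sigma>)"
  shows "step (x, b) (step (x, \<not> b) \<sigma>) = \<sigma>"
proof -
  obtain k L where \<sigma>: "\<sigma> = (k, L)" by (cases \<sigma>)
  show ?thesis
  proof (cases x)
    case gen_s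
    then show ?thesis by (simp add: \<sigma>)
  next
    case gen_t
    show ?thesis
    proof (cases "L \<noteq> [] \<and> fst (hd L) = b \<and> src (\<not> b) dvd k")
      case True
      then obtain r L' where L: "L = (b, r) # L'" by (cases L) auto
      from True obtain q where k: "k = src (\<not> b) * q" by auto
      have r: "r mod src b = r" "r = 0 \<Longrightarrow> L' = [] \<or> fst (hd L') = b"
        using assms by (simp_all add: \<sigma> L)
      then have "r div src b = 0" using div_mult_mod_eq[of r "src b"] by simp
      then have quot: "(src b * q + r) div src b = q" "(src b * q + r) mod src b = r"
        using r(1) by simp_all
      have "src b dvd src b * q + r \<Longrightarrow> r = 0"
        using quot(2) by (simp only: dvd_eq_mod_eq_0)
      then have "\<not> (L' \<noteq> [] \<and> fst (hd L') = (\<not> b) \<and> src b dvd src b * q + r)"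
        using r(2) by auto
      moreover have "step (gen_t, \<not> b) \<sigma> = (src b * q + r, L')" by (simp add: \<sigma> L k)
      ultimately show ?thesis by (simp only: gen_t step.simps quot if_False) (simp add: \<sigma> L k)
    next
      case False
      then have "step (gen_t, \<not> b) \<sigma> =
          (src b * (k div src (\<not> b)), (\<not> b, k mod src (\<not> b)) # L)"
        by (simp only: \<sigma> step.simps) auto
      then show ?thesis by (simp add: gen_t \<sigma>)
    qed
  qed
qed

lemma run_s_power: "run (word_power gen_s i) (k, L) = (k + i, L)"
proof -
  have "run (replicate j (gen_s, b)) (k, L) = (if b then k + int j else k - int j, L)" for j b
    by (induction j) auto
  then show ?thesis by (simp add: word_power_def)
qed

text \<open>Raising the exponent by \<open>m\<close> before a letter \<open>t\<close> changes its
  quotient by one but not its residue, so the result gains \<open>n\<close>, on any state; only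
  cancelling \<open>t\<close> against \<open>t^-1\<close> uses reducedness.\<close>

lemma run_relation:
  assumes "reduced (snd \<sigma>)"
  shows "step (gen_t, True) (run (word_power gen_s m) (step (gen_t, False) \<sigma>)) =
    run (word_power gen_s n) \<sigma>"
proof -
  have shift: "step (gen_t, True) (run (word_power gen_s m) \<tau>) =
      run (word_power gen_s n) (step (gen_t, True) \<tau>)" for \<tau>
    using m_nonzero n_nonzero
    by (cases \<tau>) (auto simp: run_s_power src_def algebra_simps)
  show ?thesis using step_cancel[OF assms, of gen_t True] by (simp add: shift)
qed

text \<open>Van der Waerden's argument: the letters act on reduced states by permutations obeying
  the relation, so the normal form \<open>run w (0, [])\<close> depends only on the class of
  \<open>w\<close>.\<close>

lemma run_cong: "word_equiv rels u v \<Longrightarrow> reduced (snd \<sigma>) \<Longrightarrow> run u \<sigma> = run v \<sigma>"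
proof (induction arbitrary: \<sigma> rule: word_equiv.induct)
  case (append u u' v v')
  then show ?case by (simp add: reduced_run)
next
  case (cancel x b)
  then show ?case by (simp add: step_cancel)
next
  case (relation u v)
  then show ?case using run_relation
    by (auto simp: rels_def word_power_def[of gen_t])
qed auto

section \<open>States as group elements\<close>

primrec stack_elt :: "(bool \<times> int) list \<Rightarrow> bs_gen word set" where
  "stack_elt [] = \<one>\<^bsub>BS m n\<^esub>"
| "stack_elt (a # L) =
    cls [(gen_t, fst a)] \<otimes>\<^bsub>BS m n\<^esub> S [^]\<^bsub>BS m n\<^esub> snd a \<otimes>\<^bsub>BS m n\<^esub> stack_elt L"

definition state_elt :: "state \<Rightarrow> bs_gen word set" where
  "state_elt \<sigma> = S [^]\<^bsub>BS m n\<^esub> fst \<sigma> \<otimes>\<^bsub>BS m n\<^esub> stack_elt (snd \<sigma>)"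

lemma stack_elt_closed [simp]: "stack_elt L \<in> carrier (BS m n)"
  by (induction L) auto

lemma t_letter_power:
  "cls [(gen_t, b)] \<otimes>\<^bsub>BS m n\<^esub> S [^]\<^bsub>BS m n\<^esub> (src b * q) =
    S [^]\<^bsub>BS m n\<^esub> (src (\<not> b) * q) \<otimes>\<^bsub>BS m n\<^esub> cls [(gen_t, b)]"
proof (cases b)
  case True
  then show ?thesis by (simp add: T_conj_power src_def)
next
  case False
  have "S [^]\<^bsub>BS m n\<^esub> (m * q) =
      inv\<^bsub>BS m n\<^esub> T \<otimes>\<^bsub>BS m n\<^esub> (S [^]\<^bsub>BS m n\<^esub> (n * q) \<otimes>\<^bsub>BS m n\<^esub> T)"
    by (simp add: inv_solve_left T_conj_power)
  then have "S [^]\<^bsub>BS m n\<^esub> (m * q) \<otimes>\<^bsub>BS m n\<^esub> inv\<^bsub>BS m n\<^esub> T =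
      inv\<^bsub>BS m n\<^esub> T \<otimes>\<^bsub>BS m n\<^esub> S [^]\<^bsub>BS m n\<^esub> (n * q)"
    by (simp add: inv_solve_right' m_assoc)
  with False show ?thesis by (simp add: src_def cls_inverse_letter)
qed

lemma state_elt_step: "state_elt (step a \<sigma>) = cls [a] \<otimes>\<^bsub>BS m n\<^esub> state_elt \<sigma>"
proof -
  obtain x b k L where a: "a = (x, b)" and \<sigma>: "\<sigma> = (k, L)" by (cases a; cases \<sigma>)
  show ?thesis
  proof (cases x)
    case gen_s
    have "S [^]\<^bsub>BS m n\<^esub> (k + 1) = S \<otimes>\<^bsub>BS m n\<^esub> S [^]\<^bsub>BS m n\<^esub> k"
      using int_pow_mult[of S 1 k] by (simp add: add.commute)
    moreover have "S [^]\<^bsub>BS m n\<^esub> (k - 1) = inv\<^bsub>BS m n\<^esub> S \<otimes>\<^bsub>BS m n\<^esub> S [^]\<^bsub>BS m n\<^esub> k"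
      using int_pow_mult[of S "- 1" k] by (simp add: int_pow_neg)
    ultimately show ?thesis
      by (simp add: a \<sigma> gen_s state_elt_def m_assoc cls_inverse_letter)
  next
    case gen_t
    let ?q = "k div src b" and ?r = "k mod src b"
    have k: "S [^]\<^bsub>BS m n\<^esub> k = S [^]\<^bsub>BS m n\<^esub> (src b * ?q) \<otimes>\<^bsub>BS m n\<^esub> S [^]\<^bsub>BS m n\<^esub> ?r"
      by (simp flip: int_pow_mult)
    have push: "cls [a] \<otimes>\<^bsub>BS m n\<^esub> state_elt \<sigma> =
        S [^]\<^bsub>BS m n\<^esub> (src (\<not> b) * ?q) \<otimes>\<^bsub>BS m n\<^esub>
          (cls [(gen_t, b)] \<otimes>\<^bsub>BS m n\<^esub> S [^]\<^bsub>BS m n\<^esub> ?r \<otimes>\<^bsub>BS m n\<^esub> stack_elt L)"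
      by (simp add: a \<sigma> gen_t state_elt_def k t_letter_power flip: m_assoc)
    show ?thesis
    proof (cases "L \<noteq> [] \<and> fst (hd L) = (\<not> b) \<and> src b dvd k")
      case True
      then obtain r L' where L: "L = (\<not> b, r) # L'" by (cases L) auto
      have "cls [(gen_t, b)] \<otimes>\<^bsub>BS m n\<^esub> cls [(gen_t, \<not> b)] = \<one>\<^bsub>BS m n\<^esub>"
        using word_equiv.cancel[of rels gen_t b]
        by (simp add: one_BS word_class_eq_iff flip: cls_append)
      then have "cls [(gen_t, b)] \<otimes>\<^bsub>BS m n\<^esub> stack_elt L =
          S [^]\<^bsub>BS m n\<^esub> r \<otimes>\<^bsub>BS m n\<^esub> stack_elt L'"
        by (simp add: L flip: m_assoc)
      moreover have "?r = 0" using True by (simp add: dvd_eq_mod_eq_0)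
      ultimately have "cls [a] \<otimes>\<^bsub>BS m n\<^esub> state_elt \<sigma> =
          S [^]\<^bsub>BS m n\<^esub> (src (\<not> b) * ?q) \<otimes>\<^bsub>BS m n\<^esub>
            (S [^]\<^bsub>BS m n\<^esub> r \<otimes>\<^bsub>BS m n\<^esub> stack_elt L')"
        by (simp add: push)
      then show ?thesis
        using True by (simp add: a \<sigma> gen_t L state_elt_def int_pow_mult m_assoc)
    next
      case False
      then have "step a \<sigma> = (src (\<not> b) * ?q, (b, ?r) # L)" by (auto simp: a \<sigma> gen_t)
      then show ?thesis unfolding push by (simp add: state_elt_def)
    qed
  qed
qed

text \<open>Conversely to \<open>run_cong\<close>, the normal form determines the class.\<close>

lemma state_elt_run: "state_elt (run w (0, [])) = cls w"
proof (induction w)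
  case Nil
  then show ?case by (simp add: state_elt_def one_BS[symmetric])
next
  case (Cons a w)
  then show ?case using cls_Cons[of a w] by (simp add: state_elt_step)
qed

lemma t_exp_state: "cls w = state_elt (k, L) \<Longrightarrow> t_exp w = (\<Sum>(b, r)\<leftarrow>L. t_sign b)"
proof -
  assume w: "cls w = state_elt (k, L)"
  \<comment> \<open>\<open>v\<close> spells the normal form as a word, so that invariance of
    \<open>t_exp\<close> applies.\<close>
  define v where "v = word_power gen_s k
    @ concat (map (\<lambda>(b, r). (gen_t, b) # word_power gen_s r) L)"
  have "stack_elt L = cls (concat (map (\<lambda>(b, r). (gen_t, b) # word_power gen_s r) L))"
  proof (induction L)
    case (Cons a L)
    obtain b r where a: "a = (b, r)" by (cases a)
    show ?case
      unfolding a list.map concat.simps prod.case append_Cons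
      by (subst cls_Cons) (simp add: Cons cls_append cls_word_power m_assoc)
  qed (simp add: one_BS)
  then have "cls w = cls v" by (simp add: w state_elt_def v_def cls_append cls_word_power)
  then have "t_exp w = t_exp v" by (simp add: word_class_eq_iff t_exp_cong)
  moreover have "t_exp (word_power gen_s r) = 0" for r by (simp add: word_power_def)
  then have "t_exp v = (\<Sum>(b, r)\<leftarrow>L. t_sign b)"
    unfolding v_def by (induction L) auto
  ultimately show ?thesis by simp
qed

section \<open>Elements commuting with a power of \<open>t\<close>\<close>

text \<open>Each letter removes at most one stack entry, so \<open>w\<close> never reaches below the
  top part \<open>P\<close> and acts the same whatever \<open>L\<close> lies there.\<close>

lemma run_append_stack:
  assumes "length w \<le> length P"
  obtains k' P' where "length P - length w \<le> length P'"
    and "\<And>L. run w (k, P @ L) = (k', P' @ L)"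
proof -
  have "length w \<le> length P \<Longrightarrow>
      \<exists>k' P'. length P - length w \<le> length P' \<and> (\<forall>L. run w (k, P @ L) = (k', P' @ L))"
  proof (induction w)
    case (Cons a w)
    then obtain k' P' where P': "length P - length w \<le> length P'"
      "\<And>L. run w (k, P @ L) = (k', P' @ L)" by auto
    \<comment> \<open>Fewer than \<open>length P\<close> letters have acted, so the top part is
      nonempty and alone decides the next step.\<close>
    with Cons.prems obtain c P'' where c: "P' = c # P''" by (cases P') auto
    obtain x b where a: "a = (x, b)" by (cases a)
    show ?case
    proof (cases "x = gen_t \<and> fst c = (\<not> b) \<and> src b dvd k'")
      case True
      with P' show ?thesis
        by (intro exI[of _ "fst (step a (k', P'))"] exI[of _ P'']) (auto simp: a c)
    next
      case False
      with P' show ?thesis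
        by (intro exI[of _ "fst (step a (k', P'))"] exI[of _ "snd (step a (k', P'))"])
          (cases x; auto simp: a c)
    qed
  qed auto
  with assms that show ?thesis by blast
qed

abbreviation t_word :: "nat \<Rightarrow> bs_gen word" where
  "t_word j \<equiv> replicate j (gen_t, True)"

lemma run_t_word_base: "run (t_word j) (0, []) = (0, replicate j (True, 0))"
  by (induction j) auto

text \<open>The letters \<open>t\<close> first cancel a prefix \<open>Q\<close> of letters
  \<open>t^-1\<close>, one apiece. After the first failure the top is \<open>t\<close>, so all later
  ones are pushed onto \<open>R\<close>.\<close>

lemma run_t_word:
  obtains Q L' R i k' where "L = Q @ L'" "length R + length Q = N"
    "list_all (\<lambda>c. \<not> fst c) Q" "list_all fst R"
    "run (t_word (length Q)) (k, L) = (i, L')"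
    "run (t_word N) (k, L) = (k', R @ L')"
proof -
  have "\<exists>Q L' R i k'. L = Q @ L' \<and> length R + length Q = N \<and>
    list_all (\<lambda>c. \<not> fst c) Q \<and> list_all fst R \<and>
    run (t_word (length Q)) (k, L) = (i, L') \<and> run (t_word N) (k, L) = (k', R @ L')"
  proof (induction N)
    case 0
    then show ?case by (intro exI[of _ "[]"] exI[of _ L] exI[of _ k]) auto
  next
    case (Suc N)
    then obtain Q L' R i k' where IH: "L = Q @ L'" "length R + length Q = N"
      "list_all (\<lambda>c. \<not> fst c) Q" "list_all fst R"
      "run (t_word (length Q)) (k, L) = (i, L')"
      "run (t_word N) (k, L) = (k', R @ L')" by blast
    show ?case
    proof (cases "R = [] \<and> L' \<noteq> [] \<and> \<not> fst (hd L') \<and> m dvd k'")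
      case True
      then obtain c L'' where L': "L' = c # L''" by (cases L') auto
      \<comment> \<open>With \<open>R\<close> empty, all \<open>N\<close> letters have cancelled, so
        the two recorded runs coincide.\<close>
      from True IH have "i = k'" "length Q = N" by auto
      with IH True show ?thesis
        by (intro exI[of _ "Q @ [c]"] exI[of _ L''] exI[of _ "[]"]
            exI[of _ "fst (step (gen_t, True) (k', L'))"]) (auto simp: L' src_def)
    next
      case False
      then have "step (gen_t, True) (k', R @ L') = (n * (k' div m), ((True, k' mod m) # R) @ L')"
        using IH(4) by (cases R) (auto simp: src_def)
      with IH show ?thesis
        by (intro exI[of _ Q] exI[of _ L'] exI[of _ "(True, k' mod m) # R"]) auto
    qed
  qed
  with that show ?thesis by blast
qed

text \<open>
  Let \<open>(k, L)\<close> be the normal form of \<open>w\<close>.  For large \<open>N\<close> the normal form of \<open>w t\<^sup>N\<close> ends in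
  many letters \<open>t\<close>, as \<open>w\<close> alters only the top of the stack of \<open>t\<^sup>N\<close>, while that of
  \<open>t\<^sup>N w\<close> ends in what remains of \<open>L\<close> after cancelling some letters \<open>t\<^sup>-\<^sup>1\<close>.  So \<open>L\<close> consists
  of cancellable letters \<open>t\<^sup>-\<^sup>1\<close> followed by a power of \<open>t\<close>.
\<close>

lemma commuting_with_t_power:
  assumes comm: "word_equiv rels (w @ t_word j) (t_word j @ w)"
    and j: "j > 0" and exp: "t_exp w = 0"
  obtains p i where "word_equiv rels (t_word p @ w) (word_power gen_s i @ t_word p)"
proof -
  obtain k L where w: "run w (0, []) = (k, L)" by (cases "run w (0, [])")
  \<comment> \<open>\<open>M\<close> leaves room for \<open>length w\<close> entries that
    \<open>w\<close> may alter above \<open>length L\<close> entries that must survive; the power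
    \<open>t^(j M)\<close> still commutes with \<open>w\<close>.\<close>
  define M where "M = length w + length L"
  have "word_equiv rels (w @ t_word (j * M)) (t_word (j * M) @ w)"
  proof -
    have "cls w \<otimes>\<^bsub>BS m n\<^esub> T [^]\<^bsub>BS m n\<^esub> j = T [^]\<^bsub>BS m n\<^esub> j \<otimes>\<^bsub>BS m n\<^esub> cls w"
      using comm by (simp add: cls_replicate cls_append flip: word_class_eq_iff)
    then have "cls w \<otimes>\<^bsub>BS m n\<^esub> (T [^]\<^bsub>BS m n\<^esub> j) [^]\<^bsub>BS m n\<^esub> M =
        (T [^]\<^bsub>BS m n\<^esub> j) [^]\<^bsub>BS m n\<^esub> M \<otimes>\<^bsub>BS m n\<^esub> cls w"
      using commutes_nat_pow[of "cls w" "T [^]\<^bsub>BS m n\<^esub> j" M] by simp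
    then show ?thesis
      by (simp add: cls_replicate cls_append nat_pow_pow flip: word_class_eq_iff)
  qed
  then have runs: "run w (run (t_word (j * M)) (0, [])) = run (t_word (j * M)) (k, L)"
    using run_cong[of "w @ t_word (j * M)" "t_word (j * M) @ w" "(0, [])"] w by simp
  have "M \<le> j * M" using j by simp
  moreover have "length L \<le> M" "length w \<le> M - length L" by (simp_all add: M_def)
  ultimately have "length L \<le> j * M" "length w \<le> j * M - length L" by linarith+
  have split: "replicate (j * M) (True, 0::int) =
      replicate (j * M - length L) (True, 0) @ replicate (length L) (True, 0)"
    by (subst replicate_add[symmetric], rule arg_cong[where f = "\<lambda>i. replicate i (True, 0)"])
      (use \<open>length L \<le> j * M\<close> in simp)
  have len: "length w \<le> length (replicate (j * M - length L) (True, 0::int))"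
    using \<open>length w \<le> j * M - length L\<close> by simp
  obtain k1 P where P: "run w (0, replicate (j * M) (True, 0)) =
      (k1, P @ replicate (length L) (True, 0))"
    using run_append_stack[OF len, of 0] unfolding split by metis
  obtain Q L' R i k' where QR: "L = Q @ L'" "length R + length Q = j * M"
    "list_all (\<lambda>c. \<not> fst c) Q" "list_all fst R"
    "run (t_word (length Q)) (k, L) = (i, L')"
    "run (t_word (j * M)) (k, L) = (k', R @ L')"
    by (rule run_t_word)
  \<comment> \<open>The stacks of \<open>t^(j M) w\<close> and \<open>w t^(j M)\<close> agree; their
    last \<open>length L'\<close> entries show that \<open>L'\<close> is a pure power of
    \<open>t\<close>.\<close>
  have "R @ L' = (P @ replicate (length Q) (True, 0)) @ replicate (length L') (True, 0)"
    using runs P QR by (simp add: run_t_word_base replicate_add)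
  then have L': "L' = replicate (length L') (True, 0)"
    by (metis append_eq_append_conv length_replicate)
  have "state_elt (k, L) = cls w" using state_elt_run[of w] w by simp
  \<comment> \<open>Exponent sum zero balances the letters \<open>t^-1\<close> in \<open>Q\<close>
    against the letters \<open>t\<close> in \<open>L'\<close>.\<close>
  then have "(\<Sum>(b, r)\<leftarrow>L. t_sign b) = 0"
    using t_exp_state[of w k L] exp by simp
  moreover have "(\<Sum>(b, r)\<leftarrow>Q. t_sign b) = - int (length Q)"
    using QR(3) by (induction Q) auto
  moreover have "(\<Sum>(b, r)\<leftarrow>L'. t_sign b) = int (length L')"
    by (subst L') (simp add: sum_list_replicate)
  ultimately have p: "length L' = length Q" by (simp add: QR(1))
  \<comment> \<open>Once \<open>t^p\<close> with \<open>p = length Q\<close> has cancelled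
    \<open>Q\<close>, what remains is the normal form of \<open>s^i t^p\<close>.\<close>
  have "run (t_word (length Q) @ w) (0, []) = (i, replicate (length Q) (True, 0))"
    using QR(5) w L' p by simp
  also have "\<dots> = run (word_power gen_s i @ t_word (length Q)) (0, [])"
    by (simp add: run_t_word_base run_s_power)
  finally have "cls (t_word (length Q) @ w) = cls (word_power gen_s i @ t_word (length Q))"
    by (metis state_elt_run)
  then show ?thesis using that by (simp add: word_class_eq_iff)
qed

text \<open>Conjugating by \<open>t^p\<close> turns \<open>w\<close> into \<open>s^i\<close>. Both
  \<open>w\<close> and \<open>t\<close> fix 0, so the translation \<open>s^i\<close> does too and
  \<open>i = 0\<close>.\<close>

lemma trivial_if_commuting_with_t_power:
  assumes comm: "cls w \<otimes>\<^bsub>BS m n\<^esub> T [^]\<^bsub>BS m n\<^esub> (j::nat) = T [^]\<^bsub>BS m n\<^esub> j \<otimes>\<^bsub>BS m n\<^esub> cls w"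
    and j: "j > 0" and exp: "t_exp w = 0" and fix0: "affine w 0 = 0"
  shows "cls w = \<one>\<^bsub>BS m n\<^esub>"
proof -
  have "word_equiv rels (w @ t_word j) (t_word j @ w)"
    using comm by (simp add: cls_replicate cls_append flip: word_class_eq_iff)
  then obtain p i where eq: "word_equiv rels (t_word p @ w) (word_power gen_s i @ t_word p)"
    using commuting_with_t_power j exp by blast
  have "affine (t_word p) 0 = 0" by (induction p) auto
  then have "i = 0" using affine_cong[OF eq, of 0] fix0 by simp
  then have "cls (t_word p) \<otimes>\<^bsub>BS m n\<^esub> cls w = cls (t_word p)"
    using eq by (simp add: word_power_def word_class_eq_iff flip: cls_append)
  then show ?thesis by simp
qed

section \<open>Presentability of Baumslag--Solitar groups\<close>

lemma S_pow_inj: "S [^]\<^bsub>BS m n\<^esub> (i::int) = S [^]\<^bsub>BS m n\<^esub> (j::int) \<longleftrightarrow> i = j"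
proof
  assume "S [^]\<^bsub>BS m n\<^esub> i = S [^]\<^bsub>BS m n\<^esub> j"
  then have "word_equiv rels (word_power gen_s i) (word_power gen_s j)"
    by (simp add: cls_word_power flip: word_class_eq_iff)
  then show "i = j" using affine_cong[of _ _ 0] by fastforce
qed simp

lemma countable_carrier_BS: "countable (carrier (BS m n))"
proof -
  have "(UNIV :: bs_gen set) = {gen_s, gen_t}" using bs_gen.exhaust by auto
  then have "finite (UNIV :: bs_gen set)" by (metis finite.emptyI finite.insertI)
  then have "countable (UNIV :: (bs_gen \<times> bool) set)"
    by (simp add: countable_finite finite_Prod_UNIV)
  then have "countable (lists (UNIV :: (bs_gen \<times> bool) set))" by (rule countable_lists)
  then show ?thesis by (simp add: carrier_BS)
qed

section \<open>Presentability when \<open>|m| = |n|\<close>\<close>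

lemma presentable_if_abs_eq:
  assumes eq: "\<bar>m\<bar> = \<bar>n\<bar>"
    and inf: "infinite (UNIV :: 'b set)" "infinite (UNIV :: 'c set)"
  shows "presentable_by_product TYPE('b) TYPE('c) (BS m n)"
proof -
  have "n = 1 * m \<or> n = - 1 * m" using eq by (auto simp: abs_eq_iff)
  then obtain \<sigma> where \<sigma>: "n = \<sigma> * m" "\<sigma> = 1 \<or> \<sigma> = - 1" by blast
  \<comment> \<open>Every element conjugates the powers of \<open>s^m\<close> up to a sign
    \<open>e\<close>; the signs of the letters multiply along a word.\<close>
  have conj: "\<exists>e. (e = 1 \<or> e = - 1) \<and>
      (\<forall>q::int. cls w \<otimes>\<^bsub>BS m n\<^esub> S [^]\<^bsub>BS m n\<^esub> (m * q) = S [^]\<^bsub>BS m n\<^esub> (m * (e * q)) \<otimes>\<^bsub>BS m n\<^esub> cls w)"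
        for w
  proof (induction w)
    case Nil
    then show ?case by (intro exI[of _ 1]) (simp flip: one_BS)
  next
    case (Cons a w)
    then obtain e where e: "e = 1 \<or> e = - 1"
      "\<And>q. cls w \<otimes>\<^bsub>BS m n\<^esub> S [^]\<^bsub>BS m n\<^esub> (m * q) = S [^]\<^bsub>BS m n\<^esub> (m * (e * q)) \<otimes>\<^bsub>BS m n\<^esub> cls w"
        by blast
    obtain x b where a: "a = (x, b)" by (cases a)
    have "\<exists>d. (d = 1 \<or> d = - 1) \<and>
        (\<forall>q::int. cls [a] \<otimes>\<^bsub>BS m n\<^esub> S [^]\<^bsub>BS m n\<^esub> (m * q) =
          S [^]\<^bsub>BS m n\<^esub> (m * (d * q)) \<otimes>\<^bsub>BS m n\<^esub> cls [a])"
    proof (cases x)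
      case gen_s
      have "cls [a] = S [^]\<^bsub>BS m n\<^esub> (if b then 1 else - 1 :: int)"
        by (simp add: a gen_s cls_inverse_letter int_pow_neg)
      then show ?thesis by (intro exI[of _ 1]) (simp add: add.commute flip: int_pow_mult)
    next
      case gen_t
      have "cls [a] \<otimes>\<^bsub>BS m n\<^esub> S [^]\<^bsub>BS m n\<^esub> (m * q) = S [^]\<^bsub>BS m n\<^esub> (m * (\<sigma> * q)) \<otimes>\<^bsub>BS m n\<^esub> cls [a]"
        for q
      proof -
        \<comment> \<open>For \<open>t^-1\<close> the argument is \<open>\<sigma> * q\<close>, so
          that \<open>n * (\<sigma> * q) = m * q\<close> by
          \<open>\<sigma> * \<sigma> = 1\<close>.\<close>
        have "src b * (if b then q else \<sigma> * q) = m * q"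
          "src (\<not> b) * (if b then q else \<sigma> * q) = m * (\<sigma> * q)"
          unfolding src_def using \<sigma>(2) by (auto simp: \<sigma>(1))
        then show ?thesis
          using t_letter_power[of b "if b then q else \<sigma> * q"] by (simp only: a gen_t)
      qed
      with \<sigma> show ?thesis by blast
    qed
    then obtain d where d: "d = 1 \<or> d = - 1"
      "\<And>q::int. cls [a] \<otimes>\<^bsub>BS m n\<^esub> S [^]\<^bsub>BS m n\<^esub> (m * q) =
        S [^]\<^bsub>BS m n\<^esub> (m * (d * q)) \<otimes>\<^bsub>BS m n\<^esub> cls [a]" by blast
    have "cls (a # w) \<otimes>\<^bsub>BS m n\<^esub> S [^]\<^bsub>BS m n\<^esub> (m * q) =
      S [^]\<^bsub>BS m n\<^esub> (m * (d * e * q)) \<otimes>\<^bsub>BS m n\<^esub> cls (a # w)" for q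
    proof -
      have "cls (a # w) \<otimes>\<^bsub>BS m n\<^esub> S [^]\<^bsub>BS m n\<^esub> (m * q) =
        cls [a] \<otimes>\<^bsub>BS m n\<^esub> S [^]\<^bsub>BS m n\<^esub> (m * (e * q)) \<otimes>\<^bsub>BS m n\<^esub> cls w"
        by (simp add: cls_Cons[of a w] m_assoc e)
      then show ?thesis by (simp add: d cls_Cons[of a w] m_assoc mult.assoc)
    qed
    moreover have "d * e = 1 \<or> d * e = - 1" using d e by auto
    ultimately show ?case by blast
  qed
  define z where "z = S [^]\<^bsub>BS m n\<^esub> m"
  have z [simp]: "z \<in> carrier (BS m n)" by (simp add: z_def)
  have z_inj: "inj (\<lambda>i::int. z [^]\<^bsub>BS m n\<^esub> i)"
    using m_nonzero by (auto intro!: injI simp: z_def int_pow_pow S_pow_inj)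
  define C where "C = centralizer (BS m n) z"
  have C: "subgroup C (BS m n)" unfolding C_def by (rule centralizer_subgroup[OF z])
  \<comment> \<open>Outside \<open>C\<close> the sign is \<open>-1\<close>; the two equations are
    the cases \<open>q = 1\<close> and \<open>q = -1\<close>.\<close>
  have inv_case: "g \<otimes>\<^bsub>BS m n\<^esub> z = inv\<^bsub>BS m n\<^esub> z \<otimes>\<^bsub>BS m n\<^esub> g" "g \<otimes>\<^bsub>BS m n\<^esub> inv\<^bsub>BS m n\<^esub> z =
    z \<otimes>\<^bsub>BS m n\<^esub> g"
    if g: "g \<in> carrier (BS m n)" "g \<notin> C" for g
  proof -
    obtain w where w: "g = cls w" using g by (auto simp: carrier_BS)
    obtain e where e: "e = 1 \<or> e = - 1"
      "\<And>q. g \<otimes>\<^bsub>BS m n\<^esub> S [^]\<^bsub>BS m n\<^esub> (m * q) = S [^]\<^bsub>BS m n\<^esub> (m * (e * q)) \<otimes>\<^bsub>BS m n\<^esub> g"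
        using conj[of w] w by blast
    from e(2)[of 1] e(2)[of "- 1"] e(1) g
    show "g \<otimes>\<^bsub>BS m n\<^esub> z = inv\<^bsub>BS m n\<^esub> z \<otimes>\<^bsub>BS m n\<^esub> g" "g \<otimes>\<^bsub>BS m n\<^esub> inv\<^bsub>BS m n\<^esub> z = z \<otimes>\<^bsub>BS m n\<^esub> g"
      by (auto simp: C_def centralizer_def z_def int_pow_neg)
  qed
  \<comment> \<open>If \<open>g\<close> and \<open>h\<close> both invert \<open>z\<close>, then
    \<open>g h^-1\<close> centralizes it; hence \<open>C\<close> has index at most two.\<close>
  have same_coset: "C #>\<^bsub>BS m n\<^esub> g = C #>\<^bsub>BS m n\<^esub> h"
    if g: "g \<in> carrier (BS m n)" "g \<notin> C" and h: "h \<in> carrier (BS m n)" "h \<notin> C" for g h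
  proof -
    have "inv\<^bsub>BS m n\<^esub> (h \<otimes>\<^bsub>BS m n\<^esub> z) = inv\<^bsub>BS m n\<^esub> (inv\<^bsub>BS m n\<^esub> z \<otimes>\<^bsub>BS m n\<^esub> h)"
      using inv_case(1)[OF h] by simp
    then have zh: "inv\<^bsub>BS m n\<^esub> h \<otimes>\<^bsub>BS m n\<^esub> z = inv\<^bsub>BS m n\<^esub> z \<otimes>\<^bsub>BS m n\<^esub> inv\<^bsub>BS m n\<^esub> h"
      using h(1) by (simp add: inv_mult_group)
    have "g \<otimes>\<^bsub>BS m n\<^esub> inv\<^bsub>BS m n\<^esub> h \<otimes>\<^bsub>BS m n\<^esub> z = g \<otimes>\<^bsub>BS m n\<^esub> inv\<^bsub>BS m n\<^esub> z \<otimes>\<^bsub>BS m n\<^esub> inv\<^bsub>BS m n\<^esub> h"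
      using g(1) h(1) by (simp add: m_assoc zh)
    also have "\<dots> = z \<otimes>\<^bsub>BS m n\<^esub> (g \<otimes>\<^bsub>BS m n\<^esub> inv\<^bsub>BS m n\<^esub> h)"
      unfolding inv_case(2)[OF g] using g(1) h(1) by (simp add: m_assoc)
    finally have "g \<otimes>\<^bsub>BS m n\<^esub> inv\<^bsub>BS m n\<^esub> h \<otimes>\<^bsub>BS m n\<^esub> z = z \<otimes>\<^bsub>BS m n\<^esub> (g \<otimes>\<^bsub>BS m n\<^esub> inv\<^bsub>BS m n\<^esub> h)" .
    then have "g \<otimes>\<^bsub>BS m n\<^esub> inv\<^bsub>BS m n\<^esub> h \<in> C" using g h by (simp add: C_def centralizer_def)
    moreover have "g = g \<otimes>\<^bsub>BS m n\<^esub> inv\<^bsub>BS m n\<^esub> h \<otimes>\<^bsub>BS m n\<^esub> h" using g h by (simp add: m_assoc)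
    ultimately have "g \<in> C #>\<^bsub>BS m n\<^esub> h" by (auto simp: r_coset_def)
    then show ?thesis using repr_independence[OF _ _ C] h by metis
  qed
  have finite_index: "finite (rcosets\<^bsub>BS m n\<^esub> C)"
  proof -
    \<comment> \<open>If \<open>C\<close> is the whole group, \<open>g0\<close> is arbitrary and
      every coset is \<open>C\<close> itself.\<close>
    define g0 where "g0 = (SOME g. g \<in> carrier (BS m n) \<and> g \<notin> C)"
    have "C #>\<^bsub>BS m n\<^esub> g = C \<or> C #>\<^bsub>BS m n\<^esub> g = C #>\<^bsub>BS m n\<^esub> g0" if g: "g \<in> carrier (BS m n)" for g
    proof (cases "g \<in> C")
      case True
      then show ?thesis using coset_join2[OF g C] by simp
    next
      case False
      then have "g0 \<in> carrier (BS m n) \<and> g0 \<notin> C"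
        using someI[of "\<lambda>g. g \<in> carrier (BS m n) \<and> g \<notin> C" g] g by (simp add: g0_def)
      then show ?thesis using same_coset[OF g False] by simp
    qed
    then have "rcosets\<^bsub>BS m n\<^esub> C \<subseteq> {C, C #>\<^bsub>BS m n\<^esub> g0}" by (auto simp: RCOSETS_def)
    then show ?thesis by (rule finite_subset) simp
  qed
  then show ?thesis
    using presentable_if_centralizer_finite_index[OF countable_carrier_BS z z_inj _ inf]
    by (simp only: C_def)
qed

section \<open>Affine coefficients of group elements and the converse\<close>

text \<open>\<open>dilation g\<close> and \<open>translation g\<close> are the coefficients of the affine map
  \<open>x \<mapsto> a x + c\<close> given by \<open>g\<close>.\<close>

definition representative :: "bs_gen word set \<Rightarrow> bs_gen word" where
  "representative g = (SOME w. cls w = g)"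

definition dilation :: "bs_gen word set \<Rightarrow> rat" where
  "dilation g = (of_int n / of_int m) powi t_exp (representative g)"

definition translation :: "bs_gen word set \<Rightarrow> rat" where
  "translation g = affine (representative g) 0"

lemma word_equiv_representative: "word_equiv rels (representative (cls w)) w"
proof -
  have "cls (representative (cls w)) = cls w"
    unfolding representative_def by (rule someI[of _ w]) simp
  then show ?thesis by (simp add: word_class_eq_iff)
qed

lemma dilation_cls: "dilation (cls w) = (of_int n / of_int m) powi t_exp w"
  by (simp add: dilation_def t_exp_cong[OF word_equiv_representative])

lemma translation_cls: "translation (cls w) = affine w 0"
  by (simp add: translation_def affine_cong[OF word_equiv_representative])

lemma dilation_mult:
  assumes "g \<in> carrier (BS m n)" "h \<in> carrier (BS m n)"
  shows "dilation (g \<otimes>\<^bsub>BS m n\<^esub> h) = dilation g * dilation h"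
  using assms m_nonzero n_nonzero
  by (auto simp: carrier_BS dilation_cls power_int_add simp flip: cls_append)

lemma translation_mult:
  assumes "g \<in> carrier (BS m n)" "h \<in> carrier (BS m n)"
  shows "translation (g \<otimes>\<^bsub>BS m n\<^esub> h) = translation g + dilation g * translation h"
proof -
  obtain u v where "g = cls u" "h = cls v" using assms by (auto simp: carrier_BS)
  then show ?thesis
    using affine_eq[of u "affine v 0"]
    by (simp add: dilation_cls translation_cls flip: cls_append)
qed

text \<open>The assumption enters the converse here: a rational number of absolute value other than
  1 is no root of unity.\<close>

lemma ratio_power_int_eq_1_iff:
  assumes "\<bar>m\<bar> \<noteq> \<bar>n\<bar>"
  shows "(of_int n / of_int m :: rat) powi e = 1 \<longleftrightarrow> e = 0"
proof
  define q :: rat where "q = of_int n / of_int m"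
  have "\<bar>q\<bar> \<noteq> 1"
  proof
    assume "\<bar>q\<bar> = 1"
    then have "\<bar>of_int n :: rat\<bar> = \<bar>of_int m\<bar>" using m_nonzero by (simp add: q_def field_simps)
    then have "\<bar>n\<bar> = \<bar>m\<bar>" by (simp only: of_int_eq_iff flip: of_int_abs)
    then show False using assms by simp
  qed
  moreover assume "(of_int n / of_int m :: rat) powi e = 1"
  then have "q powi e = 1" by (simp only: q_def)
  then have "q ^ nat \<bar>e\<bar> = 1"
    by (cases "e \<ge> 0") (simp_all add: power_int_def power_inverse)
  then have "\<bar>q\<bar> ^ nat \<bar>e\<bar> = 1" by (simp only: power_abs[symmetric] abs_one)
  ultimately show "e = 0"
    using power_eq_imp_eq_base[of "\<bar>q\<bar>" "nat \<bar>e\<bar>" 1] by (cases "e = 0") simp_all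
qed simp

text \<open>
  An element of \<open>A\<close> with nontrivial dilation fixes exactly one rational point, which every element
  of \<open>B\<close> then fixes too.  If \<open>B\<close> also had a nontrivial dilation, the point would be fixed by \<open>A\<close>
  and hence by a translation.  So \<open>B\<close> acts trivially on the rationals.
\<close>

lemma commuting_factor_trivial:
  fixes j k :: nat
  assumes abs: "\<bar>m\<bar> \<noteq> \<bar>n\<bar>"
    and A: "A \<subseteq> carrier (BS m n)" and B': "B \<subseteq> carrier (BS m n)"
    and comm: "\<And>a b. a \<in> A \<Longrightarrow> b \<in> B \<Longrightarrow> a \<otimes>\<^bsub>BS m n\<^esub> b = b \<otimes>\<^bsub>BS m n\<^esub> a"
    and S: "k > 0" "a1 \<in> A" "b1 \<in> B" "S [^]\<^bsub>BS m n\<^esub> k = a1 \<otimes>\<^bsub>BS m n\<^esub> b1"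
    and T: "j > 0" "a2 \<in> A" "b2 \<in> B" "T [^]\<^bsub>BS m n\<^esub> j = a2 \<otimes>\<^bsub>BS m n\<^esub> b2"
    and dil: "dilation a2 \<noteq> 1"
  shows "B \<subseteq> {\<one>\<^bsub>BS m n\<^esub>}"
proof -
  \<comment> \<open>Compares the constant terms of the affine maps of \<open>a b\<close> and
    \<open>b a\<close>.\<close>
  have cocycle: "(1 - dilation b) * translation a = (1 - dilation a) * translation b"
    if "a \<in> A" "b \<in> B" for a b
  proof -
    have "translation (a \<otimes>\<^bsub>BS m n\<^esub> b) = translation (b \<otimes>\<^bsub>BS m n\<^esub> a)"
      by (simp add: comm[OF that])
    then show ?thesis using that A B' by (auto simp: translation_mult subset_iff algebra_simps)
  qed
  have S': "dilation a1 * dilation b1 = 1" "translation a1 + dilation a1 * translation b1 \<noteq> 0"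
  proof -
    have "dilation (S [^]\<^bsub>BS m n\<^esub> k) = 1" "translation (S [^]\<^bsub>BS m n\<^esub> k) = of_nat k"
      by (simp_all add: dilation_cls translation_cls flip: cls_replicate)
    then show "dilation a1 * dilation b1 = 1" "translation a1 + dilation a1 * translation b1 \<noteq> 0"
      using S A B' by (auto simp: dilation_mult translation_mult subset_iff)
  qed
  have dil_B: "dilation b = 1" if b: "b \<in> B" for b
  proof (rule ccontr)
    assume nb: "dilation b \<noteq> 1"
    \<comment> \<open>\<open>p\<close> is the fixed point of \<open>a2\<close>;
      \<open>translation g = p * (1 - dilation g)\<close> says that \<open>g\<close> fixes
      \<open>p\<close>.\<close>
    define p where "p = translation a2 / (1 - dilation a2)"
    have pB: "translation b' = p * (1 - dilation b')" if "b' \<in> B" for b'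
      using cocycle[OF T(2) that] dil by (simp add: p_def field_simps)
    have pA: "translation a = p * (1 - dilation a)" if "a \<in> A" for a
    proof -
      have "(1 - dilation b) * translation a = (1 - dilation b) * (p * (1 - dilation a))"
        using cocycle[OF that b] pB[OF b] by (simp add: mult_ac)
      then show ?thesis using nb by simp
    qed
    \<comment> \<open>So \<open>s^k = a1 b1\<close> fixes \<open>p\<close>, impossible for a nonzero
      translation.\<close>
    have "translation a1 + dilation a1 * translation b1 = p * (1 - dilation a1 * dilation b1)"
      unfolding pA[OF S(2)] pB[OF S(3)] by (simp add: algebra_simps)
    then show False using S' by simp
  qed
  have trans_B: "translation b = 0" if "b \<in> B" for b
    using cocycle[OF T(2) that] dil dil_B[OF that] by simp
  have trivial: "b = \<one>\<^bsub>BS m n\<^esub>"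
    if b: "b \<in> B" and bT: "b \<otimes>\<^bsub>BS m n\<^esub> T [^]\<^bsub>BS m n\<^esub> j = T [^]\<^bsub>BS m n\<^esub> j \<otimes>\<^bsub>BS m n\<^esub> b" for b
  proof -
    obtain w where w: "b = cls w" using b B' by (auto simp: carrier_BS)
    have "t_exp w = 0"
      using dil_B[OF b] ratio_power_int_eq_1_iff[OF abs] by (simp add: w dilation_cls)
    then show ?thesis
      using trivial_if_commuting_with_t_power[of w j] bT T(1) trans_B[OF b]
      by (simp add: w translation_cls)
  qed
  \<comment> \<open>\<open>b2\<close> commutes with \<open>a2\<close> and with itself, hence with
    \<open>t^j = a2 b2\<close>.\<close>
  have "b2 \<otimes>\<^bsub>BS m n\<^esub> T [^]\<^bsub>BS m n\<^esub> j = T [^]\<^bsub>BS m n\<^esub> j \<otimes>\<^bsub>BS m n\<^esub> b2"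
  proof -
    have "a2 \<in> carrier (BS m n)" "b2 \<in> carrier (BS m n)" using A B' T by auto
    then show ?thesis by (simp add: T(4) comm[OF T(2,3)] m_assoc)
  qed
  then have "b2 = \<one>\<^bsub>BS m n\<^esub>" using trivial T(3) by blast
  then have "T [^]\<^bsub>BS m n\<^esub> j = a2" using T A by auto
  then show ?thesis using trivial comm[OF T(2)] by auto
qed

lemma abs_eq_if_presentable:
  assumes "presentable_by_product TYPE('b) TYPE('c) (BS m n)"
  shows "\<bar>m\<bar> = \<bar>n\<bar>"
proof (rule ccontr)
  assume abs: "\<bar>m\<bar> \<noteq> \<bar>n\<bar>"
  obtain G1 :: "'b monoid" and G2 :: "'c monoid" and \<phi> where
    groups: "group G1" "group G2" and \<phi>: "\<phi> \<in> hom (G1 \<times>\<times> G2) (BS m n)"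
    and inf: "infinite (\<phi> ` (carrier G1 \<times> {\<one>\<^bsub>G2\<^esub>}))" "infinite (\<phi> ` ({\<one>\<^bsub>G1\<^esub>} \<times> carrier G2))"
    and fin: "finite (rcosets\<^bsub>BS m n\<^esub> (\<phi> ` carrier (G1 \<times>\<times> G2)))"
    using assms unfolding presentable_by_product_def by blast
  interpret G1: group G1 by fact
  interpret G2: group G2 by fact
  interpret \<phi>: group_hom "G1 \<times>\<times> G2" "BS m n" \<phi>
    using \<phi> groups by (simp add: group_hom_def group_hom_axioms_def DirProd_group is_group)
  define A where "A = \<phi> ` (carrier G1 \<times> {\<one>\<^bsub>G2\<^esub>})"
  define B where "B = \<phi> ` ({\<one>\<^bsub>G1\<^esub>} \<times> carrier G2)"
  let ?H = "\<phi> ` carrier (G1 \<times>\<times> G2)"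
  have AB: "A \<subseteq> carrier (BS m n)" "B \<subseteq> carrier (BS m n)"
    by (auto simp: A_def B_def intro!: \<phi>.hom_closed)
  have split: "\<phi> (x, \<one>\<^bsub>G2\<^esub>) \<otimes>\<^bsub>BS m n\<^esub> \<phi> (\<one>\<^bsub>G1\<^esub>, y) = \<phi> (x, y)"
    "\<phi> (\<one>\<^bsub>G1\<^esub>, y) \<otimes>\<^bsub>BS m n\<^esub> \<phi> (x, \<one>\<^bsub>G2\<^esub>) = \<phi> (x, y)"
    if "x \<in> carrier G1" "y \<in> carrier G2" for x y
    using that by (simp_all flip: \<phi>.hom_mult)
  have comm: "a \<otimes>\<^bsub>BS m n\<^esub> b = b \<otimes>\<^bsub>BS m n\<^esub> a" if "a \<in> A" "b \<in> B" for a b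
    using that split by (auto simp: A_def B_def)
  have factor: "\<exists>a\<in>A. \<exists>b\<in>B. h = a \<otimes>\<^bsub>BS m n\<^esub> b" if "h \<in> ?H" for h
    using that split(1) by (force simp: A_def B_def)
  have H: "subgroup ?H (BS m n)" by (rule \<phi>.img_is_subgroup)
  obtain k :: nat where k: "k > 0" "S [^]\<^bsub>BS m n\<^esub> k \<in> ?H"
    using finite_index_power_mem[OF H fin] cls_closed by blast
  obtain j :: nat where j: "j > 0" "T [^]\<^bsub>BS m n\<^esub> j \<in> ?H"
    using finite_index_power_mem[OF H fin] cls_closed by blast
  obtain a1 b1 where 1: "a1 \<in> A" "b1 \<in> B" "S [^]\<^bsub>BS m n\<^esub> k = a1 \<otimes>\<^bsub>BS m n\<^esub> b1"
    using factor k by blast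
  obtain a2 b2 where 2: "a2 \<in> A" "b2 \<in> B" "T [^]\<^bsub>BS m n\<^esub> j = a2 \<otimes>\<^bsub>BS m n\<^esub> b2"
    using factor j by blast
  \<comment> \<open>The dilation of \<open>t^j\<close> is \<open>(n / m)^j\<close>, so one of
    \<open>a2\<close>, \<open>b2\<close> has nontrivial dilation; the subgroup of the other is then
    trivial, against its infinitude.\<close>
  have "dilation (T [^]\<^bsub>BS m n\<^esub> j) \<noteq> 1"
    using ratio_power_int_eq_1_iff[OF abs, of "int j"] j(1)
    by (simp add: dilation_cls flip: cls_replicate)
  then have "dilation a2 * dilation b2 \<noteq> 1" using 2 AB by (simp add: dilation_mult subset_iff)
  then consider "dilation a2 \<noteq> 1" | "dilation b2 \<noteq> 1"
    by (cases "dilation a2 = 1") auto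
  then show False
  proof cases
    case 1
    then have "B \<subseteq> {\<one>\<^bsub>BS m n\<^esub>}"
      using commuting_factor_trivial[OF abs AB comm k(1) \<open>a1 \<in> A\<close> \<open>b1 \<in> B\<close> _ j(1) 2]
        \<open>S [^]\<^bsub>BS m n\<^esub> k = a1 \<otimes>\<^bsub>BS m n\<^esub> b1\<close> by blast
    then show False using inf(2) finite_subset unfolding B_def by blast
  next
    case 2
    \<comment> \<open>The roles of \<open>A\<close> and \<open>B\<close> are exchanged, with the
      products reordered by \<open>comm\<close>.\<close>
    then have "A \<subseteq> {\<one>\<^bsub>BS m n\<^esub>}"
      using commuting_factor_trivial[OF abs AB(2,1) comm[symmetric] k(1) \<open>b1 \<in> B\<close> \<open>a1 \<in> A\<close> _ j(1)
          \<open>b2 \<in> B\<close> \<open>a2 \<in> A\<close>]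
        \<open>S [^]\<^bsub>BS m n\<^esub> k = a1 \<otimes>\<^bsub>BS m n\<^esub> b1\<close> \<open>T [^]\<^bsub>BS m n\<^esub> j =
          a2 \<otimes>\<^bsub>BS m n\<^esub> b2\<close> comm \<open>a1 \<in> A\<close> \<open>b1 \<in> B\<close> \<open>a2 \<in> A\<close> \<open>b2 \<in> B\<close>
      by metis
    then show False using inf(1) finite_subset unfolding A_def by blast
  qed
qed

end

theorem theorem6p1:
  fixes m n :: int
  assumes "m \<noteq> 0" and "n \<noteq> 0"
    and "infinite (UNIV :: 'b set)" and "infinite (UNIV :: 'c set)"
  shows "presentable_by_product TYPE('b) TYPE('c) (BS m n) \<longleftrightarrow> \<bar>m\<bar> = \<bar>n\<bar>"
proof -
  interpret baumslag_solitar m n by unfold_locales fact+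
  show ?thesis using presentable_if_abs_eq abs_eq_if_presentable assms by blast
qed

end
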